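(* Let $n,m\ge 1$ and let $0<\alpha,\beta<1$ satisfy $2\alpha < 1+\alpha\beta$. Let $I(n,m)\subset\mathbb{R}^{mn}$ be the set of all real matrices $\Theta=(\theta_j^i)_{1\le j\le m,\,1\le i\le n}$ (identified with points of $\mathbb{R}^{mn}$) such that the $n$-dimensional subspace $$\mathcal{L}_\Theta=\{(x,y)\in\mathbb{R}^n\times\mathbb{R}^m:\ y=\Theta x\}\subset\mathbb{R}^{n+m}$$ is completely irrational. Then $I(n,m)$ is $(\alpha,\beta)$-winning in $\mathbb{R}^{mn}$. In particular, $I(n,m)$ is $\alpha$-winning for every $\alpha\le\frac12$.
   Context: A linear subspace of $\mathbb{R}^d$ is rational if it has a basis consisting of integer vectors. An $n$-dimensional subspace $\mathcal{L}\subset\mathbb{R}^d$, $n<d$, is completely irrational if $\mathcal{L}\cap\mathcal{M}=\{0\}$ for every rational subspace $\mathcal{M}$ of dimension $d-n$ (equivalently, $\mathcal{L}$ is $(d-n)$-irrational: it meets every rational subspace of dimension $d-n$ trivially and meets some rational subspace of dimension $d-n+1$ nontrivially). Schmidt's $(\alpha,\beta)$-game in $\mathbb{R}^r$: players Bob and Alice alternately choose closed balls $B_1\supset A_1\supset B_2\supset A_2\supset\cdots$ with radii $\rho(A_i)=\alpha\rho(B_i)$ and $\rho(B_{i+1})=\beta\rho(A_i)$. A set $E\subset\mathbb{R}^r$ is $(\alpha,\beta)$-winning if Alice has a strategy guaranteeing $\bigcap_i A_i\subset E$ (a single point lying in $E$) regardless of Bob's play; $E$ is $\alpha$-winning if it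 is $(\alpha,\beta)$-winning for all $0<\beta<1$. *)

theory Defs
  imports "HOL-Analysis.Analysis"
begin

definition integer_vector :: "'a::euclidean_space \<Rightarrow> bool" where
  "integer_vector v \<longleftrightarrow> (\<forall>b\<in>Basis. v \<bullet> b \<in> \<int>)"

definition rational_subspace :: "'a::euclidean_space set \<Rightarrow> bool" where
  "rational_subspace M \<longleftrightarrow>
     subspace M \<and> (\<exists>B. independent B \<and> span B = M \<and> (\<forall>v\<in>B. integer_vector v))"

definition completely_irrational :: "'a::euclidean_space set \<Rightarrow> bool" where
  "completely_irrational L \<longleftrightarrow>
     subspace L \<and> dim L < DIM('a) \<and>
     (\<forall>M. rational_subspace M \<and> dim M = DIM('a) - dim L \<longrightarrow> L \<inter> M = {0})"

definition graph_subspace :: "real^'n^'m \<Rightarrow> ((real^'n) \<times> (real^'m)) set" where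
  "graph_subspace \<Theta> = {(x, y). y = \<Theta> *v x}"

text \<open>The norm on \<^typ>\<open>real^'n^'m\<close> is the Frobenius norm, so this type is
  Euclidean space of dimension \<open>mn\<close>.\<close>

definition completely_irrational_matrices :: "(real^'n^'m) set" where
  "completely_irrational_matrices = {\<Theta>. completely_irrational (graph_subspace \<Theta>)}"

text \<open>In Schmidt's game a closed ball is represented by its centre and radius. In a Euclidean
  space (of positive dimension) these are determined by the ball as a set.\<close>

definition ball_set :: "'a::euclidean_space \<times> real \<Rightarrow> 'a set" where
  "ball_set X = cball (fst X) (snd X)"

definition schmidt_move :: "real \<Rightarrow> 'a::euclidean_space \<times> real \<Rightarrow> 'a \<times> real \<Rightarrow> bool" where
  "schmidt_move \<gamma> X Y \<longleftrightarrow> snd Y = \<gamma> * snd X \<and> ball_set Y \<subseteq> ball_set X"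

definition bob_legal ::
  "real \<Rightarrow> (nat \<Rightarrow> 'a::euclidean_space \<times> real) \<Rightarrow> (nat \<Rightarrow> 'a \<times> real) \<Rightarrow> nat \<Rightarrow> bool" where
  "bob_legal \<beta> A B k \<longleftrightarrow> snd (B 0) > 0 \<and> (\<forall>i<k. schmidt_move \<beta> (A i) (B (Suc i)))"

text \<open>A strategy \<open>\<sigma>\<close> for Alice maps the list of all of Bob's moves so far to her reply. It must
  give a legal reply whenever Bob has played legally so far; otherwise Alice could win
  vacuously by leaving Bob without a legal move.\<close>

definition schmidt_winning :: "real \<Rightarrow> real \<Rightarrow> 'a::euclidean_space set \<Rightarrow> bool" where
  "schmidt_winning \<alpha> \<beta> E \<longleftrightarrow>
     (\<exists>\<sigma> :: ('a \<times> real) list \<Rightarrow> 'a \<times> real. \<forall>B :: nat \<Rightarrow> 'a \<times> real.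
        let A = (\<lambda>i. \<sigma> (map B [0..<Suc i])) in
          (\<forall>k. bob_legal \<beta> A B k \<longrightarrow> schmidt_move \<alpha> (B k) (A k)) \<and>
          ((\<forall>k. bob_legal \<beta> A B k) \<longrightarrow> (\<exists>x\<in>E. (\<Inter>i. ball_set (A i)) = {x})))"

definition alpha_winning :: "real \<Rightarrow> 'a::euclidean_space set \<Rightarrow> bool" where
  "alpha_winning \<alpha> E \<longleftrightarrow> (\<forall>\<beta>. 0 < \<beta> \<and> \<beta> < 1 \<longrightarrow> schmidt_winning \<alpha> \<beta> E)"

end

theory Submission
  imports Defs
begin

text \<open>
  For a rational subspace \<open>M\<close> of dimension \<open>m\<close>, parametrized by \<open>z \<mapsto> (C z, D z)\<close>, the matrices
  \<open>\<Theta>\<close> whose graph meets \<open>M\<close> nontrivially are the zeros of \<open>det (D - \<Theta> C)\<close>, a polynomial in the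
  entries of \<open>\<Theta>\<close> that does not vanish identically. There are countably many such \<open>M\<close>, so it
  suffices that Alice can steer the game off the zero set of one nonzero polynomial \<open>f\<close> in finitely
  many moves. By induction on the degree she first reaches a ball on which some partial derivative
  of \<open>f\<close>, hence the gradient, has no zero, and then a ball so small that the gradient is nearly
  constant. From there she keeps moving in the direction of \<open>\<plusminus>\<close>gradient; since
  \<open>1 - 2\<alpha> + \<alpha>\<beta> > 0\<close>, Bob cannot return to the zero set of \<open>f\<close>.
\<close>

section \<open>Targets that Alice reaches in finitely many moves\<close>

locale schmidt_game =
  fixes \<alpha> \<beta> :: real
  assumes alpha: "0 < \<alpha>" "\<alpha> < 1" and beta: "0 < \<beta>" "\<beta> < 1"
begin

text \<open>The ball is always one of Bob's, with Alice to move. As a least fixed point, the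
  predicate says that Alice can bring some ball of Bob into \<open>T\<close> after finitely many
  rounds, possibly none.\<close>

inductive forces :: "('a::euclidean_space \<times> real) set \<Rightarrow> 'a \<times> real \<Rightarrow> bool"
  for T where
  hit: "X \<in> T \<Longrightarrow> forces T X"
| play: "schmidt_move \<alpha> X Y \<Longrightarrow> (\<And>X'. schmidt_move \<beta> Y X' \<Longrightarrow> forces T X') \<Longrightarrow> forces T X"

lemma forces_trans:
  assumes "forces S X" and "\<And>Y. Y \<in> S \<Longrightarrow> forces T Y"
  shows "forces T X"
  using assms(1) by induction (auto intro: assms(2) play)

lemma forces_mono: "forces S X \<Longrightarrow> S \<subseteq> T \<Longrightarrow> forces T X"
  by (rule forces_trans) (auto intro: hit)

end

text \<open>The number of moves Alice needs may depend on Bob's replies without a uniform bound, so her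
  finite-time strategies are well-founded trees rather than strategies of a given length.\<close>

datatype 'p plan = Done | Play 'p "'p \<Rightarrow> 'p plan"

context schmidt_game
begin

primrec valid_plan ::
  "('a::euclidean_space \<times> real) set \<Rightarrow> ('a \<times> real) plan \<Rightarrow> 'a \<times> real \<Rightarrow> bool" where
  "valid_plan T Done X \<longleftrightarrow> X \<in> T"
| "valid_plan T (Play Y F) X \<longleftrightarrow>
     schmidt_move \<alpha> X Y \<and> (\<forall>X'. schmidt_move \<beta> Y X' \<longrightarrow> valid_plan T (F X') X')"

lemma valid_plan_reply:
  "valid_plan T (Play Y F) X \<Longrightarrow> schmidt_move \<beta> Y X' \<Longrightarrow> valid_plan T (F X') X'"
  by (simp del: split_paired_All)

text \<open>Choice gathers the plans for Bob's individual replies into one function, turning a mere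
  derivation into a tree that a strategy can follow.\<close>

lemma forces_imp_valid_plan: "forces T X \<Longrightarrow> \<exists>t. valid_plan T t X"
proof (induction rule: forces.induct)
  case (hit X)
  then show ?case by (metis valid_plan.simps(1))
next
  case (play X Y)
  then obtain F where "\<And>X'. schmidt_move \<beta> Y X' \<Longrightarrow> valid_plan T (F X') X'" by metis
  then have "valid_plan T (Play Y F) X" using play by simp
  then show ?case ..
qed

lemma move_radius_pos:
  "schmidt_move \<alpha> X Y \<Longrightarrow> 0 < snd X \<Longrightarrow> 0 < snd Y"
  "schmidt_move \<beta> X Y \<Longrightarrow> 0 < snd X \<Longrightarrow> 0 < snd Y"
  using alpha beta by (auto simp: schmidt_move_def)

lemma schmidt_move_concentric: "0 < snd X \<Longrightarrow> schmidt_move \<alpha> X (fst X, \<alpha> * snd X)"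
  using alpha by (auto simp: schmidt_move_def ball_set_def intro!: subset_cball)

text \<open>Alice has to move even if \<open>X\<close> already lies in \<open>T\<close>, so a plan
  other than \<open>Done\<close> is required. A concentric first move is harmless because
  \<open>T\<close> can be forced from every reply to it as well.\<close>

lemma forces_imp_valid_Play:
  assumes "\<And>X. 0 < snd X \<Longrightarrow> forces T X" and X: "0 < snd X"
  shows "\<exists>Y F. valid_plan T (Play Y F) X"
proof -
  let ?Y = "(fst X, \<alpha> * snd X)"
  have mv: "schmidt_move \<alpha> X ?Y" using X by (rule schmidt_move_concentric)
  have "\<exists>t. valid_plan T t X'" if "schmidt_move \<beta> ?Y X'" for X'
    using forces_imp_valid_plan assms move_radius_pos mv that by blast
  then obtain F where "\<And>X'. schmidt_move \<beta> ?Y X' \<Longrightarrow> valid_plan T (F X') X'" by metis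
  with mv have "valid_plan T (Play ?Y F) X" by simp
  then show ?thesis by blast
qed

text \<open>Alice pursues the targets one after another, starting the plan for the next target at
  the very ball that hits the current one.\<close>

lemma strategy_meeting_targets:
  fixes T :: "nat \<Rightarrow> ('a::euclidean_space \<times> real) set"
  assumes T: "\<And>k X. 0 < snd X \<Longrightarrow> forces (T k) X"
  shows "\<exists>\<sigma> :: ('a \<times> real) list \<Rightarrow> 'a \<times> real. \<forall>B.
    (\<forall>k. bob_legal \<beta> (\<lambda>i. \<sigma> (map B [0..<Suc i])) B k \<longrightarrow>
       0 < snd (B k) \<and> schmidt_move \<alpha> (B k) (\<sigma> (map B [0..<Suc k]))) \<and>
    ((\<forall>k. bob_legal \<beta> (\<lambda>i. \<sigma> (map B [0..<Suc i])) B k) \<longrightarrow> (\<forall>j. \<exists>i. B i \<in> T j))"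
proof -
  define pick where "pick k X = (SOME t. t \<noteq> Done \<and> valid_plan (T k) t X)" for k X
  have pick: "pick k X \<noteq> Done \<and> valid_plan (T k) (pick k X) X" if X: "0 < snd X" for k X
  proof -
    obtain Y F where "valid_plan (T k) (Play Y F) X"
      using forces_imp_valid_Play[OF T X] by blast
    then have "Play Y F \<noteq> Done \<and> valid_plan (T k) (Play Y F) X" by simp
    then show ?thesis unfolding pick_def by (rule someI)
  qed
  \<comment> \<open>If the continuation is \<open>Done\<close>, the ball \<open>X\<close> has just
    hit target \<open>k\<close>. The outer \<open>Done\<close> branch is a default that legal play
    never meets.\<close>
  define after where "after = (\<lambda>(k, t) X. case t of Done \<Rightarrow> (k, Done) | Play Y F \<Rightarrow>
    (if F X = Done then (Suc k, pick (Suc k) X) else (k, F X)))"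
  \<comment> \<open>A state \<open>(k, t)\<close> records the target currently pursued and the remaining plan for it.\<close>
  define state where "state = foldl after (0, Play undefined (pick 0))"
  define \<sigma> where "\<sigma> xs = (case snd (state xs) of Play Y F \<Rightarrow> Y)" for xs
  define S where "S B i = state (map B [0..<Suc i])" for B i
  have S_Suc: "S B (Suc i) = after (S B i) (B (Suc i))" for B i
    by (simp add: S_def state_def)
  \<comment> \<open>The dummy move \<open>undefined\<close> of the initial state is never played:
    its continuation \<open>pick 0\<close> installs a plan for target 0 as soon as Bob's first ball
    arrives.\<close>
  have S_0: "S B 0 = (0, pick 0 (B 0))" if "0 < snd (B 0)" for B
    using pick[OF that, of 0] by (simp add: S_def state_def after_def)
  define A where "A B i = \<sigma> (map B [0..<Suc i])" for B i
  have A: "A B i = Y" if "S B i = (j, Play Y F)" for B i j Y F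
    using that by (simp add: A_def \<sigma>_def S_def)
  \<comment> \<open>Invariant of legal play: the stored plan is valid at Bob's current ball and
    begins with a move, which makes Alice's reply legal.\<close>
  have inv: "0 < snd (B k) \<and>
      (\<exists>j Y F. S B k = (j, Play Y F) \<and> valid_plan (T j) (Play Y F) (B k))"
    if "bob_legal \<beta> (A B) B k" for B k
    using that
  proof (induction k)
    case 0
    then have "0 < snd (B 0)" by (simp add: bob_legal_def)
    with pick[of "B 0" 0] S_0 show ?case by (cases "pick 0 (B 0)") auto
  next
    case (Suc k)
    then have "bob_legal \<beta> (A B) B k" and mv: "schmidt_move \<beta> (A B k) (B (Suc k))"
      by (auto simp: bob_legal_def)
    then obtain j Y F where S: "S B k = (j, Play Y F)"
      and V: "valid_plan (T j) (Play Y F) (B k)" and pos: "0 < snd (B k)"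
      using Suc.IH by blast
    have mv': "schmidt_move \<beta> Y (B (Suc k))" using mv A[OF S] by simp
    have pos': "0 < snd (B (Suc k))" using V by (intro move_radius_pos(2)[OF mv' move_radius_pos(1)[OF _ pos]]) simp
    have V': "valid_plan (T j) (F (B (Suc k))) (B (Suc k))" using V mv' by (rule valid_plan_reply)
    have S': "S B (Suc k) = (if F (B (Suc k)) = Done then (Suc j, pick (Suc j) (B (Suc k)))
        else (j, F (B (Suc k))))"
      by (simp add: S_Suc S after_def)
    show ?case
    proof (cases "F (B (Suc k)) = Done")
      case True
      then show ?thesis using S' pick[OF pos', of "Suc j"] pos'
        by (cases "pick (Suc j) (B (Suc k))") auto
    next
      case False
      then show ?thesis using S' V' pos' by (cases "F (B (Suc k))") auto
    qed
  qed
  show ?thesis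
  proof (intro exI[of _ \<sigma>] allI conjI impI)
    fix B k assume "bob_legal \<beta> (\<lambda>i. \<sigma> (map B [0..<Suc i])) B k"
    then have "bob_legal \<beta> (A B) B k" by (simp add: A_def[abs_def])
    from inv[OF this] A show "0 < snd (B k)" "schmidt_move \<alpha> (B k) (\<sigma> (map B [0..<Suc k]))"
      unfolding A_def[symmetric] by fastforce+
  next
    fix B j assume "\<forall>k. bob_legal \<beta> (\<lambda>i. \<sigma> (map B [0..<Suc i])) B k"
    then have legal: "bob_legal \<beta> (A B) B k" for k by (simp add: A_def[abs_def])
    \<comment> \<open>Each round that does not hit target \<open>j\<close> passes to a subtree of
      the current plan, so structural induction on \<open>t\<close> shows that the target is
      hit.\<close>
    have reach: "\<exists>i'. B i' \<in> T j \<and> fst (S B i') = Suc j" if "S B i = (j, t)" for j t i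
      using that
    proof (induction t arbitrary: i)
      case Done
      then show ?case using inv[OF legal, of i] by auto
    next
      case (Play Y F)
      have V: "valid_plan (T j) (Play Y F) (B i)" using inv[OF legal, of i] Play.prems by auto
      have "schmidt_move \<beta> (A B i) (B (Suc i))" using legal[of "Suc i"] by (simp add: bob_legal_def)
      then have V': "valid_plan (T j) (F (B (Suc i))) (B (Suc i))"
        using valid_plan_reply[OF V] A[OF Play.prems] by simp
      show ?case
      proof (cases "F (B (Suc i)) = Done")
        case True
        then have "B (Suc i) \<in> T j" using V' by simp
        moreover have "fst (S B (Suc i)) = Suc j"
          using True by (simp add: S_Suc Play.prems after_def)
        ultimately show ?thesis by blast
      next
        case False
        then have "S B (Suc i) = (j, F (B (Suc i)))"
          by (simp add: S_Suc Play.prems after_def)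
        then show ?thesis using Play.IH by blast
      qed
    qed
    have "\<exists>i. fst (S B i) = j" for j
    proof (induction j)
      case 0
      have "0 < snd (B 0)" using legal[of 0] by (simp add: bob_legal_def)
      then have "fst (S B 0) = 0" by (simp add: S_0)
      then show ?case ..
    next
      case (Suc j)
      then show ?case using reach by (metis prod.collapse)
    qed
    then show "\<exists>i. B i \<in> T j" using reach by (metis prod.collapse)
  qed
qed

text \<open>Each round multiplies the radius by \<open>\<alpha> * \<beta> < 1\<close>, so the nested
  balls shrink to one point. It lies in all of Bob's balls, hence in a ball from every
  \<open>T k\<close>.\<close>

lemma winning_if_forces:
  fixes T :: "nat \<Rightarrow> ('a::euclidean_space \<times> real) set"
  assumes T: "\<And>k X. 0 < snd X \<Longrightarrow> forces (T k) X"
    and E: "\<And>x. (\<And>k. \<exists>X\<in>T k. x \<in> ball_set X) \<Longrightarrow> x \<in> E"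
  shows "schmidt_winning \<alpha> \<beta> E"
proof -
  obtain \<sigma> :: "('a \<times> real) list \<Rightarrow> 'a \<times> real" where \<sigma>:
    "\<And>B k. bob_legal \<beta> (\<lambda>i. \<sigma> (map B [0..<Suc i])) B k \<Longrightarrow>
       0 < snd (B k) \<and> schmidt_move \<alpha> (B k) (\<sigma> (map B [0..<Suc k]))"
    "\<And>B j. (\<And>k. bob_legal \<beta> (\<lambda>i. \<sigma> (map B [0..<Suc i])) B k) \<Longrightarrow> \<exists>i. B i \<in> T j"
    using strategy_meeting_targets[of T, OF T] by blast
  have "\<exists>x\<in>E. (\<Inter>i. ball_set (\<sigma> (map B [0..<Suc i]))) = {x}"
    if legal: "\<And>k. bob_legal \<beta> (\<lambda>i. \<sigma> (map B [0..<Suc i])) B k" for B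
  proof -
    define A where "A i = \<sigma> (map B [0..<Suc i])" for i
    have mA: "schmidt_move \<alpha> (B i) (A i)" and pos: "0 < snd (B i)" for i
      using \<sigma>(1)[OF legal] by (auto simp: A_def)
    have mB: "schmidt_move \<beta> (A i) (B (Suc i))" for i
      using legal[of "Suc i"] by (auto simp: bob_legal_def A_def)
    have BA: "ball_set (B (Suc i)) \<subseteq> ball_set (A i)" and AB: "ball_set (A i) \<subseteq> ball_set (B i)"
      for i using mA mB by (auto simp: schmidt_move_def)
    have rad: "snd (A i) = \<alpha> * (\<alpha> * \<beta>) ^ i * snd (B 0)" for i
    proof (induction i)
      case 0
      then show ?case using mA[of 0] by (simp add: schmidt_move_def)
    next
      case (Suc i)
      then show ?case using mA[of "Suc i"] mB[of i] by (simp add: schmidt_move_def)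
    qed
    have ab: "0 \<le> \<alpha> * \<beta>" "\<alpha> * \<beta> < 1"
      using alpha beta mult_strict_mono[of \<alpha> 1 \<beta> 1] by auto
    have "(\<lambda>i. \<alpha> * (\<alpha> * \<beta>) ^ i * snd (B 0)) \<longlonglongrightarrow> \<alpha> * 0 * snd (B 0)"
      using ab by (intro tendsto_intros LIMSEQ_realpow_zero)
    then have lim: "(\<lambda>i. snd (A i)) \<longlonglongrightarrow> 0" by (simp add: rad)
    have "\<exists>x. (\<Inter>i. ball_set (A i)) = {x}"
    proof (rule decreasing_closed_nest_sing)
      show "closed (ball_set (A i))" for i by (simp add: ball_set_def)
      show "ball_set (A i) \<noteq> {}" for i
        using move_radius_pos(1)[OF mA pos, of i] by (simp add: ball_set_def)
      show "ball_set (A j) \<subseteq> ball_set (A i)" if "i \<le> j" for i j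
        using that by (rule lift_Suc_antimono_le[rotated]) (use AB BA in blast)
      show "\<exists>i. \<forall>x\<in>ball_set (A i). \<forall>y\<in>ball_set (A i). dist x y < e" if e: "0 < e" for e
      proof -
        obtain i where i: "snd (A i) < e / 2"
          using order_tendstoD(2)[OF lim, of "e / 2"] e by (auto simp: eventually_sequentially)
        have "dist x y < e" if "x \<in> ball_set (A i)" "y \<in> ball_set (A i)" for x y
          using that i dist_triangle3[of x y "fst (A i)"] by (simp add: ball_set_def)
        then show ?thesis by blast
      qed
    qed
    then obtain x where x: "(\<Inter>i. ball_set (A i)) = {x}" ..
    have "x \<in> ball_set (B i)" for i using x AB by blast
    then have "x \<in> E" using \<sigma>(2)[OF legal] by (intro E) blast
    with x show ?thesis by (auto simp: A_def)
  qed
  with \<sigma>(1) show ?thesis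
    unfolding schmidt_winning_def Let_def by blast
qed

end

section \<open>Escaping the zero set of a polynomial\<close>

context schmidt_game
begin

text \<open>A nonempty closed ball lies in another exactly when the distance of the centres plus the
  inner radius is at most the outer radius; the positivity assumptions exclude the empty
  ball.\<close>

lemma schmidt_move_iff:
  fixes X Y :: "'a::euclidean_space \<times> real"
  assumes "0 < \<gamma>" "0 < snd X"
  shows "schmidt_move \<gamma> X Y \<longleftrightarrow>
    snd Y = \<gamma> * snd X \<and> norm (fst Y - fst X) \<le> (1 - \<gamma>) * snd X"
  using assms
  by (auto simp: schmidt_move_def ball_set_def cball_subset_cball_iff dist_norm algebra_simps
      mult_less_0_iff)

text \<open>Alice moves as far as possible in the direction \<open>u\<close>; Bob cannot undo all of it.\<close>

lemma forces_one_round: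
  fixes X :: "'a::euclidean_space \<times> real"
  assumes u: "norm u = 1" and X: "0 < snd X"
  shows "forces {X'. snd X' = \<alpha> * \<beta> * snd X \<and> ball_set X' \<subseteq> ball_set X \<and>
    (1 - 2 * \<alpha> + \<alpha> * \<beta>) * snd X \<le> (fst X' - fst X) \<bullet> u} X"
proof (rule play)
  let ?Y = "(fst X + ((1 - \<alpha>) * snd X) *\<^sub>R u, \<alpha> * snd X)"
  show mv: "schmidt_move \<alpha> X ?Y"
    using alpha X u by (subst schmidt_move_iff) auto
  fix X' assume X': "schmidt_move \<beta> ?Y X'"
  have Y: "0 < snd ?Y" using alpha X by simp
  have r: "snd X' = \<beta> * (\<alpha> * snd X)"
    and d: "norm (fst X' - fst ?Y) \<le> (1 - \<beta>) * (\<alpha> * snd X)"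
    using X' schmidt_move_iff[OF beta(1) Y] by auto
  have "- ((fst X' - fst ?Y) \<bullet> u) \<le> norm (fst X' - fst ?Y)"
    using Cauchy_Schwarz_ineq2[of "fst X' - fst ?Y" u] u by auto
  moreover have "(fst X' - fst X) \<bullet> u = (fst X' - fst ?Y) \<bullet> u + (1 - \<alpha>) * snd X"
    using u by (simp add: inner_simps dot_square_norm)
  \<comment> \<open>In units of the radius of \<open>X\<close>, Alice gains
    \<open>1 - \<alpha>\<close> and Bob takes back at most
    \<open>(1 - \<beta>) * \<alpha>\<close>.\<close>
  ultimately have "(1 - 2 * \<alpha> + \<alpha> * \<beta>) * snd X \<le> (fst X' - fst X) \<bullet> u"
    using d by (simp add: algebra_simps)
  moreover have "ball_set X' \<subseteq> ball_set X" using mv X' by (auto simp: schmidt_move_def)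
  ultimately show "forces {X'. snd X' = \<alpha> * \<beta> * snd X \<and> ball_set X' \<subseteq> ball_set X \<and>
      (1 - 2 * \<alpha> + \<alpha> * \<beta>) * snd X \<le> (fst X' - fst X) \<bullet> u} X'"
    using r by (intro hit) (simp add: mult_ac)
qed

end

lemma mean_value_gradient:
  fixes f :: "'a::euclidean_space \<Rightarrow> real"
  assumes "\<And>x. (f has_derivative (\<lambda>h. G x \<bullet> h)) (at x)"
  obtains t where "0 \<le> t" "t \<le> 1" "f y - f x = G (x + t *\<^sub>R (y - x)) \<bullet> (y - x)"
proof -
  have "((\<lambda>t. f (x + t *\<^sub>R (y - x))) has_derivative
      (\<lambda>h. G (x + t *\<^sub>R (y - x)) \<bullet> (h *\<^sub>R (y - x)))) (at t within {0..1})" for t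
  proof -
    have "((\<lambda>t. x + t *\<^sub>R (y - x)) has_derivative (\<lambda>h. h *\<^sub>R (y - x))) (at t within {0..1})"
      by (auto intro!: derivative_eq_intros)
    from has_derivative_compose[OF this assms] show ?thesis .
  qed
  from mvt_very_simple[OF zero_le_one this] show thesis using that by auto
qed

text \<open>The assumption \<open>advance\<close> makes the net gain in
  \<open>forces_one_round\<close> positive.\<close>

locale schmidt_game_hyperplane = schmidt_game +
  assumes advance: "2 * \<alpha> < 1 + \<alpha> * \<beta>"
begin

lemma ratio: "0 < \<alpha> * \<beta>" "\<alpha> * \<beta> < 1"
  using alpha beta mult_strict_mono[of \<alpha> 1 \<beta> 1] by auto

text \<open>Iterates the one-round push. Only a nonnegative total advance is recorded, since the
  purpose is to shrink the ball without giving back ground already won.\<close>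

lemma forces_rounds:
  fixes X :: "'a::euclidean_space \<times> real"
  assumes u: "norm u = 1" and X: "0 < snd X"
  shows "forces {X'. snd X' = (\<alpha> * \<beta>) ^ N * snd X \<and> ball_set X' \<subseteq> ball_set X \<and>
    0 \<le> (fst X' - fst X) \<bullet> u} X"
proof (induction N)
  case 0
  show ?case by (rule hit) simp
next
  case (Suc N)
  show ?case
  proof (rule forces_trans[OF Suc.IH])
    fix Y assume "Y \<in> {X'. snd X' = (\<alpha> * \<beta>) ^ N * snd X \<and> ball_set X' \<subseteq> ball_set X \<and>
      0 \<le> (fst X' - fst X) \<bullet> u}"
    then have r: "snd Y = (\<alpha> * \<beta>) ^ N * snd X" and Y: "ball_set Y \<subseteq> ball_set X"
      "0 \<le> (fst Y - fst X) \<bullet> u" by auto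
    have pos: "0 < snd Y" using r X ratio by simp
    have "0 < (1 - 2 * \<alpha> + \<alpha> * \<beta>) * snd Y" using pos advance by simp
    then show "forces {X'. snd X' = (\<alpha> * \<beta>) ^ Suc N * snd X \<and> ball_set X' \<subseteq> ball_set X \<and>
      0 \<le> (fst X' - fst X) \<bullet> u} Y"
      using Y r by (intro forces_mono[OF forces_one_round[OF u pos]]) (auto simp: inner_simps)
  qed
qed

lemma forces_small_ball:
  fixes X :: "'a::euclidean_space \<times> real"
  assumes X: "0 < snd X" and e: "0 < e"
  shows "forces {X'. 0 < snd X' \<and> snd X' < e \<and> ball_set X' \<subseteq> ball_set X} X"
proof -
  obtain u :: 'a where u: "norm u = 1" using vector_choose_size[of 1] by auto
  obtain N where N: "(\<alpha> * \<beta>) ^ N < e / snd X"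
    using real_arch_pow_inv[of "e / snd X" "\<alpha> * \<beta>"] X e ratio by auto
  then have "(\<alpha> * \<beta>) ^ N * snd X < e" using X by (simp add: field_simps)
  then show ?thesis
    using ratio X by (intro forces_mono[OF forces_rounds[OF u X, of N]]) auto
qed

text \<open>After one round the centre has advanced by a guaranteed amount, but the ball may still
  reach back. Further rounds in direction \<open>u\<close> shrink its radius to at most half that
  amount, and the centre does not retreat.\<close>

lemma forces_half_space:
  fixes X :: "'a::euclidean_space \<times> real"
  assumes u: "norm u = 1" and X: "0 < snd X"
  shows "forces {X'. 0 < snd X' \<and> ball_set X' \<subseteq> ball_set X \<and>
    (\<forall>y\<in>ball_set X'. (1 - 2 * \<alpha> + \<alpha> * \<beta>) / 2 * snd X \<le> (y - fst X) \<bullet> u)} X"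
proof (rule forces_trans[OF forces_one_round[OF u X]])
  define \<delta> where "\<delta> = 1 - 2 * \<alpha> + \<alpha> * \<beta>"
  have \<delta>: "0 < \<delta>" using advance by (simp add: \<delta>_def)
  fix Y assume "Y \<in> {X'. snd X' = \<alpha> * \<beta> * snd X \<and> ball_set X' \<subseteq> ball_set X \<and>
    (1 - 2 * \<alpha> + \<alpha> * \<beta>) * snd X \<le> (fst X' - fst X) \<bullet> u}"
  then have r: "snd Y = \<alpha> * \<beta> * snd X" and Y: "ball_set Y \<subseteq> ball_set X"
    "\<delta> * snd X \<le> (fst Y - fst X) \<bullet> u" by (auto simp: \<delta>_def)
  have pos: "0 < snd Y" using r X ratio by simp
  obtain N where N: "(\<alpha> * \<beta>) ^ N < \<delta> / 2"
    using real_arch_pow_inv[of "\<delta> / 2" "\<alpha> * \<beta>"] \<delta> ratio by auto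
  have "(\<alpha> * \<beta>) ^ N * snd Y \<le> \<delta> / 2 * snd X"
    using N r X ratio pos \<delta> by (intro mult_mono) (auto simp: mult_le_cancel_right1)
  moreover have "(fst Z - fst X) \<bullet> u - snd Z \<le> (y - fst X) \<bullet> u" if "y \<in> ball_set Z" for y Z
  proof -
    have "- ((y - fst Z) \<bullet> u) \<le> snd Z"
      using Cauchy_Schwarz_ineq2[of "y - fst Z" u] u that
      by (auto simp: ball_set_def dist_norm norm_minus_commute)
    then show ?thesis by (simp add: inner_simps)
  qed
  ultimately have "{X'. snd X' = (\<alpha> * \<beta>) ^ N * snd Y \<and> ball_set X' \<subseteq> ball_set Y \<and>
      0 \<le> (fst X' - fst Y) \<bullet> u} \<subseteq> {X'. 0 < snd X' \<and> ball_set X' \<subseteq> ball_set X \<and>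
      (\<forall>y\<in>ball_set X'. \<delta> / 2 * snd X \<le> (y - fst X) \<bullet> u)}"
    using Y pos ratio by (fastforce simp: inner_simps)
  then show "forces {X'. 0 < snd X' \<and> ball_set X' \<subseteq> ball_set X \<and>
      (\<forall>y\<in>ball_set X'. (1 - 2 * \<alpha> + \<alpha> * \<beta>) / 2 * snd X \<le> (y - fst X) \<bullet> u)} Y"
    unfolding \<delta>_def[symmetric] by (rule forces_mono[OF forces_rounds[OF u pos]])
qed

text \<open>On a small ball the gradient is nearly constant. Pushing along it if \<open>f\<close> is
  nonnegative at the centre, and against it otherwise, makes the linear change of \<open>f\<close>
  dominate the error and carries \<open>f\<close> away from zero.\<close>

lemma forces_nonzero_of_gradient:
  fixes f :: "'a::euclidean_space \<Rightarrow> real"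
  assumes der: "\<And>x. (f has_derivative (\<lambda>h. G x \<bullet> h)) (at x)"
    and cont: "continuous_on UNIV G"
    and X: "0 < snd X" and nz: "\<And>x. x \<in> ball_set X \<Longrightarrow> G x \<noteq> 0"
  shows "forces {X'. 0 < snd X' \<and> (\<forall>x\<in>ball_set X'. f x \<noteq> 0)} X"
proof -
  define \<delta> where "\<delta> = 1 - 2 * \<alpha> + \<alpha> * \<beta>"
  have \<delta>: "0 < \<delta>" using advance by (simp add: \<delta>_def)
  have K: "compact (ball_set X)" "ball_set X \<noteq> {}" using X by (auto simp: ball_set_def)
  have contX: "continuous_on (ball_set X) G" using cont continuous_on_subset by blast
  obtain x0 where x0: "x0 \<in> ball_set X" "\<And>x. x \<in> ball_set X \<Longrightarrow> norm (G x0) \<le> norm (G x)"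
    using continuous_attains_inf[OF K, of "\<lambda>x. norm (G x)"] contX
    by (auto intro: continuous_intros)
  define g where "g = norm (G x0)"
  have g: "0 < g" using nz x0 by (simp add: g_def)
  \<comment> \<open>The half-space push gains at least \<open>g * \<delta> / 2\<close> times the
    radius in the linear term; an oscillation below \<open>g * \<delta> / 4\<close> leaves half of
    this.\<close>
  obtain \<eta> where \<eta>: "0 < \<eta>" "\<And>x y. x \<in> ball_set X \<Longrightarrow> y \<in> ball_set X \<Longrightarrow> dist y x < \<eta> \<Longrightarrow>
      dist (G y) (G x) < g * \<delta> / 4"
    using uniformly_continuous_onE[OF compact_uniformly_continuous[OF contX K(1)], of "g * \<delta> / 4"]
      g \<delta> by (metis divide_pos_pos mult_pos_pos zero_less_numeral)
  show ?thesis
  proof (rule forces_trans[OF forces_small_ball[OF X \<eta>(1)]])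
    fix Y assume "Y \<in> {X'. 0 < snd X' \<and> snd X' < \<eta> \<and> ball_set X' \<subseteq> ball_set X}"
    then have Y: "0 < snd Y" "snd Y < \<eta>" "ball_set Y \<subseteq> ball_set X" by auto
    let ?c = "fst Y"
    have c: "?c \<in> ball_set Y" using Y by (simp add: ball_set_def)
    define s :: real where "s = (if 0 \<le> f ?c then 1 else - 1)"
    have s: "s * s = 1" "0 \<le> s * f ?c" "\<bar>s\<bar> = 1" by (auto simp: s_def)
    have gc: "g \<le> norm (G ?c)" "0 < norm (G ?c)" using x0 g c Y by (force simp: g_def)+
    define u where "u = (s / norm (G ?c)) *\<^sub>R G ?c"
    have u: "norm u = 1" using gc s by (simp add: u_def)
    have Gu: "s *\<^sub>R G ?c = norm (G ?c) *\<^sub>R u" using gc by (simp add: u_def)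
    show "forces {X'. 0 < snd X' \<and> (\<forall>x\<in>ball_set X'. f x \<noteq> 0)} Y"
    proof (rule forces_mono[OF forces_half_space[OF u Y(1)]], safe)
      fix Z y
      assume Z: "ball_set Z \<subseteq> ball_set Y" and y: "y \<in> ball_set Z" and "f y = 0"
        and adv: "\<forall>y\<in>ball_set Z. (1 - 2 * \<alpha> + \<alpha> * \<beta>) / 2 * snd Y \<le> (y - ?c) \<bullet> u"
      have yY: "norm (y - ?c) \<le> snd Y"
        using Z y by (auto simp: ball_set_def dist_norm norm_minus_commute)
      obtain t where t: "0 \<le> t" "t \<le> 1" "f y - f ?c = G (?c + t *\<^sub>R (y - ?c)) \<bullet> (y - ?c)"
        using mean_value_gradient[OF der] .
      let ?\<xi> = "?c + t *\<^sub>R (y - ?c)"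
      have near: "norm (?\<xi> - ?c) \<le> snd Y"
        using t yY mult_left_le_one_le[of "norm (y - ?c)" t] by auto
      then have "?\<xi> \<in> ball_set Y" by (simp add: ball_set_def dist_norm)
      then have "?\<xi> \<in> ball_set X" "?c \<in> ball_set X" using Y(3) c by auto
      then have "norm (G ?\<xi> - G ?c) \<le> g * \<delta> / 4"
        using \<eta>(2)[of ?c ?\<xi>] near Y(2) by (simp add: dist_norm)
      then have "norm (G ?\<xi> - G ?c) * norm (y - ?c) \<le> g * \<delta> / 4 * snd Y"
        using yY g \<delta> by (intro mult_mono) auto
      then have A: "\<bar>s * ((G ?\<xi> - G ?c) \<bullet> (y - ?c))\<bar> \<le> g * \<delta> / 4 * snd Y"
        using Cauchy_Schwarz_ineq2[of "G ?\<xi> - G ?c" "y - ?c"] s(3) by (simp add: abs_mult)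
      have "g * (\<delta> / 2 * snd Y) \<le> norm (G ?c) * ((y - ?c) \<bullet> u)"
        using adv y gc \<delta> Y(1) by (intro mult_mono) (auto simp: \<delta>_def)
      also have "\<dots> = s * (G ?c \<bullet> (y - ?c))"
        using Gu by (metis inner_commute inner_scaleR_left)
      finally have B: "g * (\<delta> / 2 * snd Y) \<le> s * (G ?c \<bullet> (y - ?c))" .
      have "s * (f y - f ?c) = s * ((G ?\<xi> - G ?c) \<bullet> (y - ?c)) + s * (G ?c \<bullet> (y - ?c))"
        by (simp add: t(3) inner_diff_left algebra_simps)
      then have "g * \<delta> / 4 * snd Y \<le> s * (f y - f ?c)" using A B by (simp add: field_simps)
      \<comment> \<open>A zero at \<open>y\<close> turns the right side into
        \<open>- s * f ?c\<close>, which is nonpositive by the choice of \<open>s\<close>.\<close>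
      then have "g * \<delta> / 4 * snd Y \<le> 0" using \<open>f y = 0\<close> s(2) by simp
      moreover have "0 < g * \<delta> / 4 * snd Y" using g \<delta> Y(1) by simp
      ultimately show False by linarith
    qed
  qed
qed

end

text \<open>Polynomials of degree at most \<open>k\<close>, in the form that the induction on the degree needs.\<close>

primrec iterated_derivative_const :: "nat \<Rightarrow> ('a::euclidean_space \<Rightarrow> real) \<Rightarrow> bool" where
  "iterated_derivative_const 0 f \<longleftrightarrow> (\<exists>c. f = (\<lambda>_. c))"
| "iterated_derivative_const (Suc k) f \<longleftrightarrow>
     (\<exists>f'. (\<forall>x. (f has_derivative f' x) (at x)) \<and>
           (\<forall>v. iterated_derivative_const k (\<lambda>x. f' x v)))"

lemma iterated_derivative_const_continuous:
  "iterated_derivative_const k f \<Longrightarrow> continuous_on UNIV f"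
proof (cases k)
  case (Suc j)
  moreover assume "iterated_derivative_const k f"
  ultimately obtain f' where "\<And>x. (f has_derivative f' x) (at x)" by auto
  then show ?thesis by (meson continuous_at_imp_continuous_on has_derivative_continuous)
qed auto

lemma iterated_derivative_const_const: "iterated_derivative_const k (\<lambda>_. c)"
proof (induction k arbitrary: c)
  case (Suc k)
  have "((\<lambda>_::'a. c) has_derivative (\<lambda>_. 0)) (at x)" for x by simp
  then show ?case using Suc.IH by (auto intro!: exI[of _ "\<lambda>_ _. 0"])
qed auto

lemma iterated_derivative_const_add:
  "iterated_derivative_const k f \<Longrightarrow> iterated_derivative_const k g \<Longrightarrow>
    iterated_derivative_const k (\<lambda>x. f x + g x)"
proof (induction k arbitrary: f g)
  case (Suc k)
  then obtain f' g' where "\<And>x. (f has_derivative f' x) (at x)" "\<And>x. (g has_derivative g' x) (at x)"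
    and "\<And>v. iterated_derivative_const k (\<lambda>x. f' x v)" "\<And>v. iterated_derivative_const k (\<lambda>x. g' x v)"
    by auto
  then show ?case using Suc.IH
    by (auto intro!: exI[of _ "\<lambda>x v. f' x v + g' x v"] has_derivative_add)
qed auto

lemma iterated_derivative_const_scale:
  "iterated_derivative_const k f \<Longrightarrow> iterated_derivative_const k (\<lambda>x. c * f x)"
proof (induction k arbitrary: f)
  case (Suc k)
  then obtain f' where "\<And>x. (f has_derivative f' x) (at x)"
    and "\<And>v. iterated_derivative_const k (\<lambda>x. f' x v)"
    by auto
  then show ?case using Suc.IH
    by (auto intro!: exI[of _ "\<lambda>x v. c * f' x v"] has_derivative_mult_right)
qed auto

lemma iterated_derivative_const_sum:
  assumes "\<And>i. i \<in> I \<Longrightarrow> iterated_derivative_const k (f i)"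
  shows "iterated_derivative_const k (\<lambda>x. \<Sum>i\<in>I. f i x)"
  using assms
  by (induction I rule: infinite_finite_induct)
    (auto intro: iterated_derivative_const_const iterated_derivative_const_add)

text \<open>By the product rule the derivative along \<open>v\<close> is
  \<open>(c + l x) * f' x v + l v * f x\<close>: the induction hypothesis covers the first summand,
  and the second is a constant multiple of \<open>f\<close>. Affine factors are what the expansion
  of a determinant calls for.\<close>

lemma iterated_derivative_const_mult_affine:
  assumes l: "bounded_linear l" and f: "iterated_derivative_const k f"
  shows "iterated_derivative_const (Suc k) (\<lambda>x. (c + l x) * f x)"
  using f
proof (induction k arbitrary: f)
  case 0
  then obtain d where f: "f = (\<lambda>_. d)" by auto
  have "((\<lambda>x. (c + l x) * d) has_derivative (\<lambda>v. l v * d)) (at x)" for x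
    by (auto intro!: derivative_eq_intros bounded_linear_imp_has_derivative[OF l])
  then show ?case by (auto simp: f intro!: exI[of _ "\<lambda>_ v. l v * d"])
next
  case (Suc k)
  then obtain f' where f': "\<And>x. (f has_derivative f' x) (at x)"
    and f'k: "\<And>v. iterated_derivative_const k (\<lambda>x. f' x v)"
    by auto
  have "((\<lambda>x. (c + l x) * f x) has_derivative (\<lambda>v. (c + l x) * f' x v + l v * f x)) (at x)" for x
    by (auto intro!: derivative_eq_intros bounded_linear_imp_has_derivative[OF l] f')
  moreover have "iterated_derivative_const (Suc k) (\<lambda>x. (c + l x) * f' x v + l v * f x)" for v
    using Suc.IH[OF f'k] Suc.prems
    by (intro iterated_derivative_const_add iterated_derivative_const_scale)
  ultimately show ?case
    unfolding iterated_derivative_const.simps(2)[of "Suc k"]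
    by (intro exI[of _ "\<lambda>x v. (c + l x) * f' x v + l v * f x"]) simp
qed

lemma iterated_derivative_const_prod_affine:
  assumes "finite I" and "\<And>i. i \<in> I \<Longrightarrow> bounded_linear (l i)"
  shows "iterated_derivative_const (card I) (\<lambda>x. \<Prod>i\<in>I. c i + l i x)"
  using assms
proof (induction I rule: finite_induct)
  case empty
  then show ?case by (auto intro: iterated_derivative_const_const)
next
  case (insert i I)
  then show ?case
    using iterated_derivative_const_mult_affine[of "l i" "card I" _ "c i"] by simp
qed

text \<open>Induction on the degree. If the derivative vanishes identically, \<open>f\<close> is a
  nonzero constant. Otherwise Alice first avoids the zeros of one directional derivative, so the
  gradient has no zero on the ball reached.\<close>

lemma (in schmidt_game_hyperplane) forces_nonzero:
  fixes f :: "'a::euclidean_space \<Rightarrow> real"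
  assumes "iterated_derivative_const k f" "\<exists>x. f x \<noteq> 0" "0 < snd X"
  shows "forces {X'. 0 < snd X' \<and> (\<forall>x\<in>ball_set X'. f x \<noteq> 0)} X"
  using assms
proof (induction k arbitrary: f X)
  case 0
  then show ?case by (auto intro: hit)
next
  case (Suc k)
  then obtain f' where f': "\<And>x. (f has_derivative f' x) (at x)"
    and f'k: "\<And>v. iterated_derivative_const k (\<lambda>x. f' x v)"
    by auto
  show ?case
  proof (cases "\<forall>x v. f' x v = 0")
    case True
    then have "f' x = (\<lambda>_. 0)" for x by auto
    then have "f x = f y" for x y
      using has_derivative_zero_unique[of UNIV f x y] f' by auto
    then have "f x \<noteq> 0" for x using Suc.prems(2) by metis
    then show ?thesis using Suc.prems(3) by (auto intro: hit)
  next
    case False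
    then obtain v where v: "\<exists>x. f' x v \<noteq> 0" by blast
    \<comment> \<open>The gradient: the vector representing the linear form \<open>f' x\<close> by
      the inner product.\<close>
    define G where "G x = (\<Sum>b\<in>Basis. f' x b *\<^sub>R b)" for x
    have G: "f' x h = G x \<bullet> h" for x h
    proof -
      interpret bounded_linear "f' x" using f' by (rule has_derivative_bounded_linear)
      have "f' x h = f' x (\<Sum>b\<in>Basis. (h \<bullet> b) *\<^sub>R b)" by (simp add: euclidean_representation)
      also have "\<dots> = G x \<bullet> h"
        by (simp add: sum scaleR G_def inner_sum_left inner_commute[of h] mult.commute)
      finally show ?thesis .
    qed
    have der: "(f has_derivative (\<lambda>h. G x \<bullet> h)) (at x)" for x
      using f'[of x] by (simp add: G[abs_def])
    have cont: "continuous_on UNIV G"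
      unfolding G_def[abs_def]
      by (intro continuous_intros iterated_derivative_const_continuous[OF f'k])
    show ?thesis
      by (rule forces_trans[OF Suc.IH[OF f'k v Suc.prems(3)]])
        (auto intro!: forces_nonzero_of_gradient[OF der cont] simp: G)
  qed
qed

section \<open>Graphs transversal to a subspace\<close>

text \<open>The orthogonal complement of the kernel already maps onto the range, so the rank is at
  most the codimension of the kernel.\<close>

lemma dim_kernel_add_dim_range_le:
  fixes D :: "'a::euclidean_space \<Rightarrow> 'b::euclidean_space"
  assumes "linear D"
  shows "dim {z. D z = 0} + dim (range D) \<le> DIM('a)"
proof -
  interpret linear D by fact
  let ?K = "{z. D z = 0}"
  let ?P = "{y \<in> UNIV. \<forall>x\<in>?K. orthogonal x y}"
  have K: "subspace ?K" by (simp add: subspace_def add scale)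
  have "range D \<subseteq> D ` ?P"
  proof safe
    fix x
    obtain y z where yz: "y \<in> span ?K" "\<And>w. w \<in> span ?K \<Longrightarrow> orthogonal z w" "x = y + z"
      using orthogonal_subspace_decomp_exists[of ?K x] by blast
    have "D x = D z" using yz K by (simp add: span_eq_iff[THEN iffD2] add)
    moreover have "z \<in> ?P" using yz(2) by (auto simp: orthogonal_commute span_base)
    ultimately show "D x \<in> D ` ?P" by blast
  qed
  then have "dim (range D) \<le> dim (D ` ?P)" by (rule dim_subset)
  also have "\<dots> \<le> dim ?P" using assms by (rule dim_image_le)
  finally show ?thesis
    using dim_subspace_orthogonal_to_vectors[OF K subspace_UNIV] by simp
qed

text \<open>Serves to show that the determinant polynomial is not identically zero. If
  \<open>D z = g (C z)\<close>, then \<open>D z\<close> is orthogonal to itself, hence zero; as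
  \<open>g\<close> is isometric on the image of the kernel of \<open>D\<close>, also
  \<open>C z = 0\<close>.\<close>

lemma exists_transversal_graph:
  fixes C :: "'a::euclidean_space \<Rightarrow> 'b::euclidean_space"
    and D :: "'a \<Rightarrow> 'c::euclidean_space"
  assumes C: "linear C" and D: "linear D" and dim: "DIM('a) \<le> DIM('c)"
    and inj: "\<And>z. C z = 0 \<Longrightarrow> D z = 0 \<Longrightarrow> z = 0"
  obtains g where "linear g" "\<And>z. D z = g (C z) \<Longrightarrow> z = 0"
proof -
  \<comment> \<open>\<open>g\<close> embeds \<open>C (ker D)\<close> into the orthogonal complement of the range of \<open>D\<close> and takes no
    values outside that complement.\<close>
  let ?K = "{z. D z = 0}"
  let ?W = "{y \<in> UNIV. \<forall>x\<in>range D. orthogonal x y}"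
  have K: "subspace ?K" using D by (simp add: subspace_def linear_0 linear_add linear_cmul)
  have R: "subspace (range D)" using D by (simp add: linear_subspace_image)
  have W: "subspace ?W" by (auto simp: subspace_def orthogonal_def inner_simps)
  have CK: "subspace (C ` ?K)" using C K by (rule linear_subspace_image)
  \<comment> \<open>Dimension count: the complement \<open>?W\<close> is large enough to receive the
    image of the kernel isometrically.\<close>
  have "dim (C ` ?K) \<le> dim ?K" using C by (rule dim_image_le)
  also have "\<dots> \<le> dim ?W"
    using dim_kernel_add_dim_range_le[OF D] dim
      dim_subspace_orthogonal_to_vectors[OF R subspace_UNIV] by simp
  finally obtain f where f: "linear f" "f \<in> C ` ?K \<rightarrow> ?W" "\<And>x. x \<in> C ` ?K \<Longrightarrow> norm (f x) = norm x"
    using isometry_subset_subspace[OF CK W] by blast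
  obtain B where B: "B \<subseteq> C ` ?K" "independent B" "C ` ?K \<subseteq> span B"
    using maximal_independent_subset by blast
  \<comment> \<open>The isometry \<open>f\<close> is known to map into \<open>?W\<close> only on the
    image of the kernel. Extending it anew from the basis \<open>B\<close> keeps the whole range of
    \<open>g\<close> inside \<open>?W\<close>.\<close>
  obtain g where g: "linear g" "\<And>x. x \<in> B \<Longrightarrow> g x = f x" "range g = span (f ` B)"
    using linear_independent_extend_subspace[OF B(2), of f] by blast
  have "f ` B \<subseteq> ?W" using B(1) f(2) by blast
  then have gW: "range g \<subseteq> ?W" using g(3) W by (simp add: span_minimal)
  have gf: "g x = f x" if "x \<in> C ` ?K" for x
    using linear_eq_on_span[OF g(1) f(1) g(2)] B(3) that by blast
  show thesis
  proof (rule that[OF g(1)])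
    fix z assume z: "D z = g (C z)"
    have "g (C z) \<in> ?W" using gW by blast
    then have "orthogonal (D z) (D z)" unfolding z[symmetric] by blast
    then have Dz: "D z = 0" by (simp add: orthogonal_def)
    then have "norm (g (C z)) = norm (C z)" using gf f(3) by auto
    then have "C z = 0" using Dz z by simp
    with Dz show "z = 0" by (rule inj[rotated])
  qed
qed

lemma linear_parametrization:
  fixes M :: "'a::euclidean_space set"
  assumes "subspace M" "dim M = CARD('m::finite)"
  obtains \<phi> :: "real^'m \<Rightarrow> 'a" where "linear \<phi>" "inj \<phi>" "range \<phi> = M"
proof -
  have "dim (UNIV :: (real^'m) set) = dim M" using assms by simp
  then obtain \<phi> :: "real^'m \<Rightarrow> 'a" where "linear \<phi>" "\<phi> ` UNIV = M" "inj_on \<phi> UNIV"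
    using subspace_isomorphism[OF subspace_UNIV assms(1)] by metis
  then show thesis using that by blast
qed

text \<open>Since \<open>M\<close> has dimension \<open>CARD('m)\<close>, the map
  \<open>D - \<Theta> C\<close> is given by a square matrix. Its determinant is nonzero exactly when
  \<open>z = 0\<close> is the only parameter whose point of \<open>M\<close> lies on the
  graph.\<close>

lemma transversality_polynomial:
  fixes M :: "((real^'n) \<times> (real^'m)) set"
  assumes "subspace M" "dim M = CARD('m)"
  obtains f :: "real^'n^'m \<Rightarrow> real" where
    "iterated_derivative_const CARD('m) f" "\<exists>\<Theta>. f \<Theta> \<noteq> 0"
    "\<And>\<Theta>. f \<Theta> \<noteq> 0 \<Longrightarrow> graph_subspace \<Theta> \<inter> M = {0}"
proof -
  obtain \<phi> :: "real^'m \<Rightarrow> (real^'n) \<times> (real^'m)" where \<phi>: "linear \<phi>" "inj \<phi>" "range \<phi> = M"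
    using linear_parametrization[OF assms] .
  define C where "C z = fst (\<phi> z)" for z
  define D where "D z = snd (\<phi> z)" for z
  have C: "linear C" and D: "linear D"
    unfolding C_def[abs_def] D_def[abs_def]
    using \<phi>(1) linear_compose[OF \<phi>(1) linear_fst] linear_compose[OF \<phi>(1) linear_snd]
    by (simp_all add: o_def)
  have inj: "z = 0" if "C z = 0" "D z = 0" for z
  proof -
    have "\<phi> z = 0" using that by (simp add: C_def D_def prod_eq_iff)
    then show ?thesis using linear_injective_0[OF \<phi>(1)] \<phi>(2) by blast
  qed
  define L where "L \<Theta> z = D z - \<Theta> *v C z" for \<Theta> :: "real^'n^'m" and z
  have L: "linear (L \<Theta>)" for \<Theta>
    unfolding L_def[abs_def]
    using linear_compose[OF C matrix_vector_mul_linear[of \<Theta>]] D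
    by (auto intro!: linear_compose_sub simp: o_def)
  define f where "f \<Theta> = det (matrix (L \<Theta>))" for \<Theta>
  have f_iff: "f \<Theta> \<noteq> 0 \<longleftrightarrow> (\<forall>z. D z = \<Theta> *v C z \<longrightarrow> z = 0)" for \<Theta>
    using det_nz_iff_inj[OF L] linear_injective_0[OF L] by (auto simp: f_def L_def)
  show thesis
  proof (rule that[of f])
    \<comment> \<open>\<open>l p i\<close> is minus the entry \<open>(i, p i)\<close> of the matrix
      of \<open>\<Theta> C\<close>. Each term of the Leibniz expansion is thus a constant times a
      product of \<open>CARD('m)\<close> affine functions of \<open>\<Theta>\<close>.\<close>
    define l where "l p i \<Theta> = - (\<Sum>j\<in>UNIV. \<Theta> $ i $ j * C (axis (p i) 1) $ j)"
      for p :: "'m \<Rightarrow> 'm" and i and \<Theta> :: "real^'n^'m"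
    have l: "bounded_linear (l p i)" for p i
      unfolding l_def[abs_def]
      by (intro bounded_linear_minus bounded_linear_sum bounded_linear_mult_const
          bounded_linear_compose[OF bounded_linear_vec_nth bounded_linear_vec_nth])
    have "f = (\<lambda>\<Theta>. \<Sum>p | p permutes UNIV. of_int (sign p) *
        (\<Prod>i\<in>UNIV. D (axis (p i) 1) $ i + l p i \<Theta>))"
      by (simp add: fun_eq_iff f_def det_def matrix_def L_def l_def matrix_vector_mult_def)
    then show "iterated_derivative_const CARD('m) f"
      by (auto intro!: iterated_derivative_const_sum iterated_derivative_const_scale
          iterated_derivative_const_prod_affine l)
    obtain g where g: "linear g" "\<And>z. D z = g (C z) \<Longrightarrow> z = 0"
      using exists_transversal_graph[OF C D order_refl inj] by blast
    then have "f (matrix g) \<noteq> 0"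
      unfolding f_iff using fun_cong[OF matrix_vector_mul(2)[OF g(1)]] by simp
    then show "\<exists>\<Theta>. f \<Theta> \<noteq> 0" ..
    fix \<Theta> assume nz: "f \<Theta> \<noteq> 0"
    show "graph_subspace \<Theta> \<inter> M = {0}"
    proof (intro equalityI subsetI)
      fix w assume w: "w \<in> graph_subspace \<Theta> \<inter> M"
      then obtain z where z: "w = \<phi> z" using \<phi>(3) by blast
      have "D z = \<Theta> *v C z" using w by (auto simp: z graph_subspace_def C_def D_def)
      then have "z = 0" using nz f_iff by blast
      then show "w \<in> {0}" using z linear_0[OF \<phi>(1)] by simp
    next
      fix w :: "(real^'n) \<times> (real^'m)" assume "w \<in> {0}"
      then show "w \<in> graph_subspace \<Theta> \<inter> M"
        using subspace_0[OF assms(1)] by (simp add: graph_subspace_def zero_prod_def)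
    qed
  qed
qed

section \<open>Countability of the rational subspaces and assembly of the game\<close>

text \<open>A rational subspace is the span of a finite set of integer vectors, and a countable set
  has only countably many finite subsets.\<close>

lemma countable_rational_subspaces:
  "countable {M :: 'a::euclidean_space set. rational_subspace M}"
proof -
  let ?Z = "{v :: 'a. integer_vector v}"
  have "countable ((\<lambda>c. \<Sum>b\<in>Basis. c b *\<^sub>R b) ` (Basis \<rightarrow>\<^sub>E (\<int> :: real set)) :: 'a set)"
    by (intro countable_image countable_PiE) (auto simp: Ints_def)
  moreover have "?Z \<subseteq> (\<lambda>c. \<Sum>b\<in>Basis. c b *\<^sub>R b) ` (Basis \<rightarrow>\<^sub>E (\<int> :: real set))"
  proof
    fix v :: 'a assume "v \<in> ?Z"
    then have "restrict (\<lambda>b. v \<bullet> b) Basis \<in> Basis \<rightarrow>\<^sub>E (\<int> :: real set)"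
      by (auto simp: integer_vector_def)
    moreover have "v = (\<Sum>b\<in>Basis. restrict (\<lambda>b. v \<bullet> b) Basis b *\<^sub>R b)"
      by (simp add: euclidean_representation)
    ultimately show "v \<in> (\<lambda>c. \<Sum>b\<in>Basis. c b *\<^sub>R b) ` (Basis \<rightarrow>\<^sub>E (\<int> :: real set))"
      by blast
  qed
  ultimately have "countable ?Z" by (rule countable_subset[rotated])
  then have "countable (span ` {B. finite B \<and> B \<subseteq> ?Z})"
    by (intro countable_image countable_Collect_finite_subset)
  moreover have "{M :: 'a set. rational_subspace M} \<subseteq> span ` {B. finite B \<and> B \<subseteq> ?Z}"
    by (auto simp: rational_subspace_def intro!: imageI dest: independent_imp_finite)
  ultimately show ?thesis by (rule countable_subset[rotated])
qed

lemma subspace_graph_subspace: "subspace (graph_subspace \<Theta>)"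
  by (auto simp: graph_subspace_def subspace_def zero_prod_def matrix_vector_right_distrib
      matrix_vector_mult_scaleR)

lemma dim_graph_subspace: "dim (graph_subspace (\<Theta> :: real^'n^'m)) = CARD('n)"
proof -
  let ?g = "\<lambda>x. (x, \<Theta> *v x)"
  have g: "linear ?g" by (intro linearI) (auto simp: matrix_vector_right_distrib matrix_vector_mult_scaleR)
  have "graph_subspace \<Theta> = ?g ` UNIV" by (auto simp: graph_subspace_def)
  moreover have "dim (?g ` UNIV) = dim (UNIV :: (real^'n) set)"
    by (rule dim_image_eq[OF g]) (auto simp: inj_on_def)
  ultimately show ?thesis by simp
qed

text \<open>The graph has dimension \<open>CARD('n)\<close> in a space of dimension
  \<open>CARD('n) + CARD('m)\<close>, so it is proper and has complementary dimension
  \<open>CARD('m)\<close>.\<close>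

lemma completely_irrational_matrices_iff:
  "\<Theta> \<in> (completely_irrational_matrices :: (real^'n^'m) set) \<longleftrightarrow>
    (\<forall>M. rational_subspace M \<and> dim M = CARD('m) \<longrightarrow> graph_subspace \<Theta> \<inter> M = {0})"
  by (simp add: completely_irrational_matrices_def completely_irrational_def
      subspace_graph_subspace dim_graph_subspace)

text \<open>Each rational subspace of dimension \<open>CARD('m)\<close> contributes one target: the
  balls free of zeros of its polynomial.\<close>

lemma (in schmidt_game_hyperplane) completely_irrational_matrices_winning:
  "schmidt_winning \<alpha> \<beta> (completely_irrational_matrices :: (real^'n^'m) set)"
proof -
  let ?\<M> = "{M :: ((real^'n) \<times> (real^'m)) set. rational_subspace M \<and> dim M = CARD('m)}"
  have cnt: "countable ?\<M>"
    by (rule countable_subset[OF _ countable_rational_subspaces]) auto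
  \<comment> \<open>Outside the family the constant 1 serves as default polynomial, so every index
    of the enumeration yields a target that can be forced.\<close>
  define good where "good M f \<longleftrightarrow> iterated_derivative_const CARD('m) f \<and> (\<exists>\<Theta>. f \<Theta> \<noteq> 0) \<and>
      (M \<in> ?\<M> \<longrightarrow> (\<forall>\<Theta>. f \<Theta> \<noteq> 0 \<longrightarrow> graph_subspace \<Theta> \<inter> M = {0}))"
    for M and f :: "real^'n^'m \<Rightarrow> real"
  have "\<exists>f. good M f" for M
  proof (cases "M \<in> ?\<M>")
    case True
    then have "subspace M" "dim M = CARD('m)" by (auto simp: rational_subspace_def)
    then obtain f :: "real^'n^'m \<Rightarrow> real" where
      "iterated_derivative_const CARD('m) f" "\<exists>\<Theta>. f \<Theta> \<noteq> 0"
      "\<And>\<Theta>. f \<Theta> \<noteq> 0 \<Longrightarrow> graph_subspace \<Theta> \<inter> M = {0}"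
      using transversality_polynomial[of M] by blast
    then have "good M f" by (simp add: good_def)
    then show ?thesis by blast
  next
    case False
    then have "good M (\<lambda>_. 1)" by (auto simp: good_def iterated_derivative_const_const)
    then show ?thesis by blast
  qed
  then obtain F where "\<And>M. good M (F M)" by metis
  then have F: "\<And>M. iterated_derivative_const CARD('m) (F M)" "\<And>M. \<exists>\<Theta>. F M \<Theta> \<noteq> 0"
      "\<And>M \<Theta>. M \<in> ?\<M> \<Longrightarrow> F M \<Theta> \<noteq> 0 \<Longrightarrow> graph_subspace \<Theta> \<inter> M = {0}"
    unfolding good_def by blast+
  show ?thesis
  proof (rule winning_if_forces)
    show "forces {X'. 0 < snd X' \<and> (\<forall>x\<in>ball_set X'. F (from_nat_into ?\<M> k) x \<noteq> 0)} X"
      if "0 < snd X" for k X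
      using F(1,2) that by (rule forces_nonzero)
    fix \<Theta> :: "real^'n^'m"
    assume hit: "\<And>k. \<exists>X\<in>{X'. 0 < snd X' \<and> (\<forall>x\<in>ball_set X'. F (from_nat_into ?\<M> k) x \<noteq> 0)}.
      \<Theta> \<in> ball_set X"
    show "\<Theta> \<in> completely_irrational_matrices"
      unfolding completely_irrational_matrices_iff
    proof (intro allI impI)
      fix M :: "((real^'n) \<times> (real^'m)) set"
      assume "rational_subspace M \<and> dim M = CARD('m)"
      then have M: "M \<in> ?\<M>" by simp
      then obtain k where "from_nat_into ?\<M> k = M" using from_nat_into_surj[OF cnt] by blast
      then show "graph_subspace \<Theta> \<inter> M = {0}" using hit[of k] F(3)[OF M] by auto
    qed
  qed
qed

theorem theorem2p1:
  shows "(\<forall>\<alpha> \<beta>. 0 < \<alpha> \<and> \<alpha> < 1 \<and> 0 < \<beta> \<and> \<beta> < 1 \<and> 2 * \<alpha> < 1 + \<alpha> * \<beta> \<longrightarrow>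
           schmidt_winning \<alpha> \<beta> (completely_irrational_matrices :: (real^'n^'m) set)) \<and>
         (\<forall>\<alpha>. 0 < \<alpha> \<and> \<alpha> \<le> 1/2 \<longrightarrow>
           alpha_winning \<alpha> (completely_irrational_matrices :: (real^'n^'m) set))"
proof -
  have win: "schmidt_winning \<alpha> \<beta> (completely_irrational_matrices :: (real^'n^'m) set)"
    if "0 < \<alpha>" "\<alpha> < 1" "0 < \<beta>" "\<beta> < 1" "2 * \<alpha> < 1 + \<alpha> * \<beta>" for \<alpha> \<beta>
  proof -
    interpret schmidt_game_hyperplane \<alpha> \<beta> using that by unfold_locales
    show ?thesis by (rule completely_irrational_matrices_winning)
  qed
  moreover have "2 * \<alpha> < 1 + \<alpha> * \<beta>" if "0 < \<alpha>" "\<alpha> \<le> 1/2" "0 < \<beta>" for \<alpha> \<beta> :: real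
    using that mult_pos_pos[of \<alpha> \<beta>] by linarith
  ultimately show ?thesis by (auto simp: alpha_winning_def)
qed

end
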